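(* Let $p$ be a prime, $n \geq 1$ an integer and $F = GF(p^n)$. Let $$A(n,p) = \left\lbrace V(a,b,c) = \begin{bmatrix} 1 & 0 & 0\\ a & 1 & 0\\ b & c & 1 \end{bmatrix} : a, b, c \in F \right\rbrace,$$ a group under matrix multiplication, given by $V(a,b,c)V(a',b',c') = V(a+a', b+b'+ca', c+c')$. Then the Laplacian spectrum of the non-commuting graph $\mathcal{A}_{A(n,p)}$ of $A(n,p)$ is $$\{0, (p^{3n}-p^{2n})^{p^{3n}-2p^n-1}, (p^{3n}-p^n)^{p^n}\}.$$
   Context: For a finite non-abelian group $G$ with centre $Z(G)$, the non-commuting graph $\mathcal{A}_G$ is the simple undirected graph with vertex set $G \setminus Z(G)$ in which two vertices $x,y$ are adjacent if and only if $xy \neq yx$. The Laplacian matrix of a finite graph is $D - A$, with $D$ the degree matrix and $A$ the adjacency matrix. The Laplacian spectrum is the multiset of eigenvalues of the Laplacian matrix; $\{\dots,\alpha^{a},\dots\}$ means the eigenvalue $\alpha$ is listed with multiplicity $a$ (not a power; no exponent means once, exponent $0$ means the entry is absent, and if listed values coincide their multiplicities add). *)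

theory Defs
  imports
    "HOL-Algebra.Group"
    "HOL-Computational_Algebra.Primes"
    "Graph_Theory.Pair_Digraph"
    "Jordan_Normal_Form.Char_Poly"
begin

definition group_center :: "('a, 'm) monoid_scheme \<Rightarrow> 'a set" where
  "group_center G =
     {z \<in> carrier G. \<forall>g \<in> carrier G. z \<otimes>\<^bsub>G\<^esub> g = g \<otimes>\<^bsub>G\<^esub> z}"

text \<open>Simple undirected graphs are the graphs of the locale \<open>pair_graph\<close>: each undirected edge
  is represented by both of its orientations.\<close>

definition non_commuting_graph :: "('a, 'm) monoid_scheme \<Rightarrow> 'a pair_pre_digraph" where
  "non_commuting_graph G =
     \<lparr> pverts = carrier G - group_center G,
       parcs = {(x, y). x \<in> carrier G - group_center G \<and> y \<in> carrier G - group_center G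
                  \<and> x \<otimes>\<^bsub>G\<^esub> y \<noteq> y \<otimes>\<^bsub>G\<^esub> x} \<rparr>"

lemma pair_graph_non_commuting_graph:
  assumes "finite (carrier G)"
  shows "pair_graph (non_commuting_graph G)"
proof
  show "finite (pverts (non_commuting_graph G))"
    using assms by (simp add: non_commuting_graph_def)
  show "finite (parcs (non_commuting_graph G))"
    by (rule finite_subset[of _ "carrier G \<times> carrier G"])
       (use assms in \<open>auto simp: non_commuting_graph_def\<close>)
  show "symmetric (with_proj (non_commuting_graph G))"
    by (auto simp: symmetric_def sym_def non_commuting_graph_def)
qed (auto simp: non_commuting_graph_def)

text \<open>The matrices of a graph depend on an enumeration \<open>vs\<close> of its vertices. In the symmetric
  representation the degree of a vertex is the number of arcs leaving it.\<close>

definition degree_matrix :: "'a pair_pre_digraph \<Rightarrow> 'a list \<Rightarrow> real mat" where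
  "degree_matrix G vs = mat (length vs) (length vs)
     (\<lambda>(i, j). if i = j then real (out_degree (with_proj G) (vs ! i)) else 0)"

definition adjacency_matrix :: "'a pair_pre_digraph \<Rightarrow> 'a list \<Rightarrow> real mat" where
  "adjacency_matrix G vs = mat (length vs) (length vs)
     (\<lambda>(i, j). if (vs ! i, vs ! j) \<in> parcs G then 1 else 0)"

definition laplacian_matrix :: "'a pair_pre_digraph \<Rightarrow> 'a list \<Rightarrow> real mat" where
  "laplacian_matrix G vs = degree_matrix G vs - adjacency_matrix G vs"

text \<open>Eigenvalues are counted with their multiplicity as roots of the characteristic polynomial.
  The Laplacian matrix is real symmetric, so all its eigenvalues are real. The choice of the
  enumeration is immaterial, see \<open>laplacian_spectrum_eq\<close> below.\<close>

definition laplacian_spectrum :: "'a pair_pre_digraph \<Rightarrow> real multiset" where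
  "laplacian_spectrum G =
     proots (char_poly (laplacian_matrix G (SOME vs. distinct vs \<and> set vs = pverts G)))"

lemma char_poly_laplacian_matrix_cong:
  assumes "distinct vs" "distinct ws" "set vs = set ws"
  shows "char_poly (laplacian_matrix G vs) = char_poly (laplacian_matrix G ws)"
proof (rule char_poly_similar)
  define n where "n = length vs"
  have n': "length ws = n"
    using assms distinct_card[of vs] distinct_card[of ws] by (simp add: n_def)
  have "\<forall>i. \<exists>k. i < n \<longrightarrow> k < n \<and> ws ! k = vs ! i"
    using assms(3) n' unfolding n_def by (metis in_set_conv_nth)
  then obtain f where f: "\<And>i. i < n \<Longrightarrow> f i < n \<and> ws ! f i = vs ! i" by metis
  have inj: "f i = f j \<longleftrightarrow> i = j" if "i < n" "j < n" for i j
    using f[OF that(1)] f[OF that(2)] assms(1) that nth_eq_iff_index_eq[of vs i j]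
    by (auto simp: n_def)
  have "inj_on f {..<n}" using inj by (auto simp: inj_on_def)
  then have img: "f ` {..<n} = {..<n}"
    by (intro endo_inj_surj) (use f in auto)
  define P :: "real mat" where "P = mat n n (\<lambda>(i, j). if j = f i then 1 else 0)"
  define Q :: "real mat" where "Q = mat n n (\<lambda>(i, j). if i = f j then 1 else 0)"
  let ?A = "laplacian_matrix G vs" and ?B = "laplacian_matrix G ws"
  have dims: "?A \<in> carrier_mat n n" "?B \<in> carrier_mat n n" "P \<in> carrier_mat n n"
    "Q \<in> carrier_mat n n"
    by (auto simp: laplacian_matrix_def adjacency_matrix_def degree_matrix_def P_def Q_def n' n_def)
  have PM: "(P * M) $$ (i, j) = M $$ (f i, j)"
    if "M \<in> carrier_mat n n" "i < n" "j < n" for M i j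
  proof -
    have "(P * M) $$ (i, j) = (\<Sum>k\<in>{0..<n}. (if k = f i then 1 else 0) * M $$ (k, j))"
      using that by (auto simp: P_def scalar_prod_def intro!: sum.cong)
    also have "\<dots> = (\<Sum>k\<in>{0..<n}. if k = f i then M $$ (k, j) else 0)"
      by (rule sum.cong) auto
    also have "\<dots> = M $$ (f i, j)" using f[OF that(2)] by simp
    finally show ?thesis .
  qed
  have MQ: "(M * Q) $$ (i, j) = M $$ (i, f j)"
    if "M \<in> carrier_mat n n" "i < n" "j < n" for M i j
  proof -
    have "(M * Q) $$ (i, j) = (\<Sum>k\<in>{0..<n}. M $$ (i, k) * (if k = f j then 1 else 0))"
      using that by (auto simp: Q_def scalar_prod_def intro!: sum.cong)
    also have "\<dots> = (\<Sum>k\<in>{0..<n}. if k = f j then M $$ (i, k) else 0)"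
      by (rule sum.cong) auto
    also have "\<dots> = M $$ (i, f j)" using f[OF that(3)] by simp
    finally show ?thesis .
  qed
  have PQ: "P * Q = 1\<^sub>m n"
  proof (rule eq_matI)
    fix i j assume ij: "i < dim_row (1\<^sub>m n :: real mat)" "j < dim_col (1\<^sub>m n :: real mat)"
    then have "(P * Q) $$ (i, j) = Q $$ (f i, j)" using PM[OF dims(4)] by simp
    then show "(P * Q) $$ (i, j) = 1\<^sub>m n $$ (i, j)"
      using ij f inj by (auto simp: Q_def)
  qed (use dims in auto)
  have QP: "Q * P = 1\<^sub>m n"
    by (rule mat_mult_left_right_inverse[OF dims(3,4) PQ])
  have "?A = P * ?B * Q"
  proof (rule eq_matI)
    fix i j assume "i < dim_row (P * ?B * Q)" "j < dim_col (P * ?B * Q)"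
    then have ij: "i < n" "j < n" using dims by auto
    then have "(P * ?B * Q) $$ (i, j) = ?B $$ (f i, f j)"
      using MQ[OF mult_carrier_mat[OF dims(3,2)]] PM[OF dims(2)] f by simp
    also have "\<dots> = ?A $$ (i, j)"
      using ij f[OF ij(1)] f[OF ij(2)] inj[OF ij] n'
      by (simp add: laplacian_matrix_def adjacency_matrix_def degree_matrix_def n_def)
    finally show "?A $$ (i, j) = (P * ?B * Q) $$ (i, j)" by simp
  qed (use dims in auto)
  then show "similar_mat ?A ?B"
    by (intro similar_matI[of _ _ P Q n]) (use dims PQ QP in auto)
qed

lemma laplacian_spectrum_eq:
  assumes "distinct vs" "set vs = pverts G"
  shows "laplacian_spectrum G = proots (char_poly (laplacian_matrix G vs))"
proof -
  let ?ws = "SOME vs. distinct vs \<and> set vs = pverts G"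
  have "distinct ?ws \<and> set ?ws = pverts G" by (rule someI[of _ vs]) (use assms in simp)
  then show ?thesis
    unfolding laplacian_spectrum_def using assms char_poly_laplacian_matrix_cong[of ?ws vs G] by simp
qed

definition V_mat :: "'a::field \<Rightarrow> 'a \<Rightarrow> 'a \<Rightarrow> 'a mat" where
  "V_mat a b c = mat_of_rows_list 3
     [[1, 0, 0],
      [a, 1, 0],
      [b, c, 1]]"

text \<open>The group \<open>A(n, p)\<close>, where the field \<open>GF(p^n)\<close> is given by the type argument.\<close>

definition A_group :: "'a::field itself \<Rightarrow> 'a mat monoid" where
  "A_group _ = \<lparr> carrier = {V_mat a b c | a b c. True}, mult = (*), one = 1\<^sub>m 3 \<rparr>"

lemma V_mat_mult:
  "V_mat a b c * V_mat a' b' c' = V_mat (a + a') (b + b' + c * a') (c + c')"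
  by (rule eq_matI)
     (auto simp: V_mat_def mat_of_rows_list_def scalar_prod_def less_Suc_eq numeral_eq_Suc)

lemma V_mat_zero: "V_mat 0 0 0 = 1\<^sub>m 3"
  by (rule eq_matI) (auto simp: V_mat_def mat_of_rows_list_def less_Suc_eq numeral_eq_Suc)

lemma group_A_group: "group (A_group TYPE('a::field))"
proof (rule groupI)
  fix x assume "x \<in> carrier (A_group TYPE('a))"
  then obtain a b c where x: "x = V_mat a b c" by (auto simp: A_group_def)
  show "\<exists>y \<in> carrier (A_group TYPE('a)). y \<otimes>\<^bsub>A_group TYPE('a)\<^esub> x = \<one>\<^bsub>A_group TYPE('a)\<^esub>"
    by (rule bexI[of _ "V_mat (- a) (c * a - b) (- c)"])
       (auto simp: A_group_def x V_mat_mult V_mat_zero)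
  show "\<one>\<^bsub>A_group TYPE('a)\<^esub> \<otimes>\<^bsub>A_group TYPE('a)\<^esub> x = x"
    by (simp add: A_group_def x V_mat_mult flip: V_mat_zero)
qed (force simp: A_group_def V_mat_mult algebra_simps simp flip: V_mat_zero)+

lemma finite_A_group: "finite (carrier (A_group TYPE('a::{field, finite})))"
proof -
  have "carrier (A_group TYPE('a)) = (\<lambda>(a, b, c). V_mat a b c) ` UNIV"
    by (auto simp: A_group_def image_def)
  then show ?thesis by simp
qed

end

theory Submission
  imports Defs
begin

text \<open>Non-central elements \<open>V(a,b,c)\<close> and \<open>V(a',b',c')\<close> commute iff \<open>(a,c)\<close> and \<open>(a',c')\<close>
  span the same line of \<open>F\<^sup>2\<close>. With \<open>q = p\<^sup>n\<close>, the graph is therefore complete multipartite with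
  \<open>q + 1\<close> classes of size \<open>q (q - 1)\<close>. Its Laplacian matrix is a scalar matrix plus a matrix that
  factors through the classes, so two applications of Sylvester's determinant identity reduce its
  characteristic polynomial to that of a \<open>1 \<times> 1\<close> matrix.\<close>

section \<open>Characteristic polynomials of low-rank perturbations of scalar matrices\<close>

text \<open>The zero block stays zero in the characteristic matrix, whose determinant therefore
  splits over the diagonal blocks.\<close>

lemma char_poly_four_block_upper_right_zero:
  fixes A :: "'a::idom mat"
  assumes A: "A \<in> carrier_mat n n" and C: "C \<in> carrier_mat m n" and D: "D \<in> carrier_mat m m"
  shows "char_poly (four_block_mat A (0\<^sub>m n m) C D) = char_poly A * char_poly D"
proof -
  have "char_poly_matrix (four_block_mat A (0\<^sub>m n m) C D)
      = four_block_mat (char_poly_matrix A) (0\<^sub>m n m) (map_mat (\<lambda>a. [:- a:]) C) (char_poly_matrix D)"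
    by (rule eq_matI) (use A C D in \<open>auto simp: char_poly_matrix_def one_poly_def\<close>)
  also have "det \<dots> = det (char_poly_matrix A) * det (char_poly_matrix D)"
    by (rule det_four_block_mat_upper_right_zero[OF _ refl])
       (use A C D in \<open>auto simp: char_poly_matrix_def\<close>)
  finally show ?thesis by (simp add: char_poly_def)
qed

lemma char_poly_scalar_mat:
  "char_poly (c \<cdot>\<^sub>m 1\<^sub>m n :: 'a::comm_ring_1 mat) = [:- c, 1:] ^ n"
proof -
  have "char_poly (c \<cdot>\<^sub>m 1\<^sub>m n) = (\<Prod>a\<leftarrow>diag_mat (c \<cdot>\<^sub>m 1\<^sub>m n). [:- a, 1:])"
    by (rule char_poly_upper_triangular[of _ n]) auto
  also have "diag_mat (c \<cdot>\<^sub>m 1\<^sub>m n) = replicate n c"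
    by (rule nth_equalityI) (auto simp: diag_mat_def)
  finally show ?thesis by (simp add: prod_list_replicate)
qed

text \<open>Sylvester's determinant identity. The matrices \<open>[[c I + P Q, 0], [Q, c I]]\<close> and
  \<open>[[c I, 0], [Q, c I + Q P]]\<close> are conjugate under \<open>[[I, P], [0, I]]\<close>.\<close>

lemma char_poly_scalar_add_mult_commute:
  fixes P Q :: "'a::idom mat"
  assumes P: "P \<in> carrier_mat n m" and Q: "Q \<in> carrier_mat m n"
  shows "char_poly (c \<cdot>\<^sub>m 1\<^sub>m n + P * Q) * [:- c, 1:] ^ m
       = [:- c, 1:] ^ n * char_poly (c \<cdot>\<^sub>m 1\<^sub>m m + Q * P)"
proof -
  define M where "M = four_block_mat (c \<cdot>\<^sub>m 1\<^sub>m n + P * Q) (0\<^sub>m n m) Q (c \<cdot>\<^sub>m 1\<^sub>m m)"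
  define M' where "M' = four_block_mat (c \<cdot>\<^sub>m 1\<^sub>m n) (0\<^sub>m n m) Q (c \<cdot>\<^sub>m 1\<^sub>m m + Q * P)"
  define S where "S = four_block_mat (1\<^sub>m n) P (0\<^sub>m m n) (1\<^sub>m m)"
  define T where "T = four_block_mat (1\<^sub>m n) (- P) (0\<^sub>m m n) (1\<^sub>m m)"
  have carrier: "M \<in> carrier_mat (n + m) (n + m)" "M' \<in> carrier_mat (n + m) (n + m)"
    "S \<in> carrier_mat (n + m) (n + m)" "T \<in> carrier_mat (n + m) (n + m)"
    using P Q by (auto simp: M_def M'_def S_def T_def)
  have "S * T = four_block_mat (1\<^sub>m n) (0\<^sub>m n m) (0\<^sub>m m n) (1\<^sub>m m)"
    unfolding S_def T_def mult_four_block_mat[OF one_carrier_mat P zero_carrier_mat one_carrier_mat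
        one_carrier_mat uminus_carrier_mat[OF P] zero_carrier_mat one_carrier_mat]
    by (rule arg_cong4[where f = four_block_mat]; rule eq_matI) (use P in auto)
  then have ST: "S * T = 1\<^sub>m (n + m)" by simp
  have "T * S = four_block_mat (1\<^sub>m n) (0\<^sub>m n m) (0\<^sub>m m n) (1\<^sub>m m)"
    unfolding S_def T_def mult_four_block_mat[OF one_carrier_mat uminus_carrier_mat[OF P]
        zero_carrier_mat one_carrier_mat one_carrier_mat P zero_carrier_mat one_carrier_mat]
    by (rule arg_cong4[where f = four_block_mat]; rule eq_matI) (use P in auto)
  then have TS: "T * S = 1\<^sub>m (n + m)" by simp
  have cI: "c \<cdot>\<^sub>m 1\<^sub>m k \<in> carrier_mat k k" for k by simp
  have PQ: "c \<cdot>\<^sub>m 1\<^sub>m n + P * Q \<in> carrier_mat n n" and QP: "c \<cdot>\<^sub>m 1\<^sub>m m + Q * P \<in> carrier_mat m m"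
    using P Q by auto
  \<comment> \<open>This is the upper right block of both \<open>M * S\<close> and
    \<open>S * M'\<close>, and the only one whose equality is not immediate; it rests on
    \<open>(P * Q) * P = P * (Q * P)\<close>.\<close>
  have "(c \<cdot>\<^sub>m 1\<^sub>m n + P * Q) * P = c \<cdot>\<^sub>m P + P * Q * P"
    using add_mult_distrib_mat[OF cI mult_carrier_mat[OF P Q] P]
      mult_smult_assoc_mat[OF one_carrier_mat P] left_mult_one_mat[OF P] by simp
  also have "\<dots> = c \<cdot>\<^sub>m P + P * (Q * P)"
    using assoc_mult_mat[OF P Q P] by simp
  also have "\<dots> = P * (c \<cdot>\<^sub>m 1\<^sub>m m + Q * P)"
    using mult_add_distrib_mat[OF P cI mult_carrier_mat[OF Q P]]
      mult_smult_distrib[OF P one_carrier_mat] right_mult_one_mat[OF P] by simp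
  finally have corner: "(c \<cdot>\<^sub>m 1\<^sub>m n + P * Q) * P = P * (c \<cdot>\<^sub>m 1\<^sub>m m + Q * P)" .
  have "M * S = S * M'"
    unfolding M_def M'_def S_def
      mult_four_block_mat[OF PQ zero_carrier_mat Q cI one_carrier_mat P zero_carrier_mat one_carrier_mat]
      mult_four_block_mat[OF one_carrier_mat P zero_carrier_mat one_carrier_mat cI zero_carrier_mat Q QP]
      corner
    by (rule arg_cong4[where f = four_block_mat]; rule eq_matI) (use P Q in auto)
  then have "S * M' * T = M"
    using carrier ST by (metis assoc_mult_mat right_mult_one_mat)
  then have "similar_mat M M'"
    by (intro similar_matI[of _ _ S T "n + m"]) (use carrier ST TS in auto)
  then have "char_poly M = char_poly M'" by (rule char_poly_similar)
  moreover have "char_poly M = char_poly (c \<cdot>\<^sub>m 1\<^sub>m n + P * Q) * [:- c, 1:] ^ m"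
    unfolding M_def using P Q
    by (subst char_poly_four_block_upper_right_zero) (auto simp: char_poly_scalar_mat)
  moreover have "char_poly M' = [:- c, 1:] ^ n * char_poly (c \<cdot>\<^sub>m 1\<^sub>m m + Q * P)"
    unfolding M'_def using P Q
    by (subst char_poly_four_block_upper_right_zero) (auto simp: char_poly_scalar_mat)
  ultimately show ?thesis by simp
qed

text \<open>Characteristic polynomials are monic, hence nonzero, so \<open>proots\<close> turns the
  products in Sylvester's identity into multiset sums.\<close>

lemma proots_char_poly_scalar_add_mult_commute:
  fixes P Q :: "'a::idom mat"
  assumes P: "P \<in> carrier_mat n m" and Q: "Q \<in> carrier_mat m n"
  shows "proots (char_poly (c \<cdot>\<^sub>m 1\<^sub>m n + P * Q)) + replicate_mset m c
       = replicate_mset n c + proots (char_poly (c \<cdot>\<^sub>m 1\<^sub>m m + Q * P))"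
proof -
  have nz: "char_poly A \<noteq> 0" if "A \<in> carrier_mat k k" for A :: "'a mat" and k
    using degree_monic_char_poly[OF that] by auto
  have "char_poly (c \<cdot>\<^sub>m 1\<^sub>m n + P * Q) \<noteq> 0" "char_poly (c \<cdot>\<^sub>m 1\<^sub>m m + Q * P) \<noteq> 0"
    using nz[of "c \<cdot>\<^sub>m 1\<^sub>m n + P * Q" n] nz[of "c \<cdot>\<^sub>m 1\<^sub>m m + Q * P" m] P Q by auto
  then show ?thesis
    using arg_cong[OF char_poly_scalar_add_mult_commute[OF P Q, of c], of proots]
    by (simp add: proots_mult proots_power)
qed

section \<open>Complete multipartite graphs\<close>

text \<open>With \<open>c = m (k - 1)\<close> the Laplacian matrix is \<open>c I - J + E E\<^sup>T\<close>, where \<open>E\<close> is the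
  incidence matrix between vertices and classes; since \<open>J = E J E\<^sup>T\<close>, it equals
  \<open>c I + E (I - J) E\<^sup>T\<close>, and \<open>E\<^sup>T E = m I\<close>. Below, \<open>P = E\<close>, \<open>Q = (I - J) E\<^sup>T\<close>
  and \<open>u w = - m J\<close>.\<close>

lemma laplacian_spectrum_complete_multipartite:
  fixes f :: "'v \<Rightarrow> 'b"
  assumes S: "finite S" "card S = k" "k > 0"
    and V: "finite (pverts G)" "f ` pverts G \<subseteq> S"
    and parts: "\<And>s. s \<in> S \<Longrightarrow> card {v \<in> pverts G. f v = s} = m" and m: "m > 0"
    and arcs: "parcs G = {(x, y). x \<in> pverts G \<and> y \<in> pverts G \<and> f x \<noteq> f y}"
  shows "laplacian_spectrum G = {#0#} + replicate_mset (k * (m - 1)) (real (m * (k - 1)))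
           + replicate_mset (k - 1) (real (m * k))"
proof -
  obtain vs where vs: "distinct vs" "set vs = pverts G"
    using finite_distinct_list[OF V(1)] by blast
  obtain ss where ss: "distinct ss" "set ss = S"
    using finite_distinct_list[OF S(1)] by blast
  define n where "n = length vs"
  have lss: "length ss = k" using ss S distinct_card by metis
  have "pverts G = (\<Union>s\<in>S. {v \<in> pverts G. f v = s})" using V(2) by auto
  then have "n = card (\<Union>s\<in>S. {v \<in> pverts G. f v = s})"
    using vs distinct_card[OF vs(1)] unfolding n_def by simp
  also have "\<dots> = (\<Sum>s\<in>S. card {v \<in> pverts G. f v = s})"
    by (rule card_UN_disjoint) (use S V in auto)
  also have "\<dots> = k * m" using parts S by simp
  finally have n: "n = k * m" .
  define c where "c = real (m * (k - 1))"
  \<comment> \<open>Since \<open>k > 0\<close>, the truncated difference \<open>k - 1\<close> is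
    exact and casts to a real difference.\<close>
  have c: "c = real k * real m - real m"
    using S(3) by (simp add: c_def of_nat_diff algebra_simps)
  have deg: "real (out_degree (with_proj G) x) = c" if "x \<in> pverts G" for x
  proof -
    \<comment> \<open>The neighbours of \<open>x\<close> are all vertices outside its class,
      \<open>k * m - m\<close> in number.\<close>
    have "out_arcs (with_proj G) x = Pair x ` (pverts G - {v \<in> pverts G. f v = f x})"
      using that by (auto simp: out_arcs_def arcs)
    then have "out_degree (with_proj G) x = card (pverts G - {v \<in> pverts G. f v = f x})"
      by (simp add: out_degree_def card_image inj_on_def)
    also have "\<dots> = k * m - m"
      using that V parts[of "f x"] n distinct_card[OF vs(1)]
      by (subst card_Diff_subset) (auto simp: n_def vs)
    finally show ?thesis using S(3) by (simp add: c of_nat_diff)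
  qed
  define P :: "real mat" where "P = mat n k (\<lambda>(i, j). if f (vs ! i) = ss ! j then 1 else 0)"
  \<comment> \<open>Each column of E^T has a single 1, so J E^T has all entries 1; this is the
    subtracted 1.\<close>
  define Q :: "real mat" where "Q = mat k n (\<lambda>(j, i). (if f (vs ! i) = ss ! j then 1 else 0) - 1)"
  define u :: "real mat" where "u = mat k 1 (\<lambda>_. - real m)"
  define w :: "real mat" where "w = mat 1 k (\<lambda>_. 1)"
  have dims: "P \<in> carrier_mat n k" "Q \<in> carrier_mat k n" "u \<in> carrier_mat k 1" "w \<in> carrier_mat 1 k"
    by (auto simp: P_def Q_def u_def w_def)
  have V_nth: "vs ! i \<in> pverts G" if "i < n" for i using that vs(2) nth_mem[of i vs] by (simp add: n_def)
  have sum_vs: "(\<Sum>i<n. g (vs ! i)) = (\<Sum>v\<in>pverts G. g v)" for g :: "'v \<Rightarrow> real"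
    using sum_list_distinct_conv_sum_set[OF vs(1), of g] vs(2)
    by (simp add: sum_list_sum_nth n_def atLeast0LessThan)
  have sum_ss: "(\<Sum>j<k. g (ss ! j)) = (\<Sum>s\<in>S. g s)" for g :: "'b \<Rightarrow> real"
    using sum_list_distinct_conv_sum_set[OF ss(1), of g] ss(2)
    by (simp add: sum_list_sum_nth lss atLeast0LessThan)
  have L: "laplacian_matrix G vs = c \<cdot>\<^sub>m 1\<^sub>m n + P * Q"
  proof (rule eq_matI)
    fix i j assume "i < dim_row (c \<cdot>\<^sub>m 1\<^sub>m n + P * Q)" "j < dim_col (c \<cdot>\<^sub>m 1\<^sub>m n + P * Q)"
    then have ij: "i < n" "j < n" using dims by auto
    have fS: "f (vs ! i) \<in> S" using V V_nth ij by auto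
    \<comment> \<open>Only the class of vertex \<open>i\<close> contributes, giving 0 within a class
      and -1 across classes. The diagonal is thus 0, which leaves the degree \<open>c\<close>
      there.\<close>
    have "(P * Q) $$ (i, j) =
      (\<Sum>l<k. (if f (vs ! i) = ss ! l then (if f (vs ! j) = ss ! l then 1 else 0) - 1 else 0))"
      using ij by (auto simp: P_def Q_def scalar_prod_def atLeast0LessThan intro!: sum.cong)
    also have "\<dots> = (\<Sum>s\<in>S. if f (vs ! i) = s then (if f (vs ! j) = s then 1 else 0) - 1 else 0)"
      by (rule sum_ss)
    also have "\<dots> = (if f (vs ! j) = f (vs ! i) then 1 else 0) - 1"
      using S fS by (simp add: sum.delta')
    finally show "laplacian_matrix G vs $$ (i, j) = (c \<cdot>\<^sub>m 1\<^sub>m n + P * Q) $$ (i, j)"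
      using ij dims V_nth[OF ij(1)] V_nth[OF ij(2)] vs(1) deg
      by (auto simp: laplacian_matrix_def degree_matrix_def adjacency_matrix_def arcs
          simp flip: n_def)
  qed (use dims in \<open>auto simp: laplacian_matrix_def degree_matrix_def adjacency_matrix_def n_def\<close>)
  \<comment> \<open>As E^T E = m I, \<open>Q * P\<close> is m (I - J); with c + m = m k the
    remainder - m J has rank one.\<close>
  have QP: "c \<cdot>\<^sub>m 1\<^sub>m k + Q * P = real (m * k) \<cdot>\<^sub>m 1\<^sub>m k + u * w"
  proof (rule eq_matI)
    fix i j assume "i < dim_row (real (m * k) \<cdot>\<^sub>m 1\<^sub>m k + u * w)"
      "j < dim_col (real (m * k) \<cdot>\<^sub>m 1\<^sub>m k + u * w)"
    then have ij: "i < k" "j < k" using dims by auto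
    have sS: "ss ! i \<in> S" "ss ! j \<in> S" using ij lss ss by auto
    have eq: "ss ! i = ss ! j \<longleftrightarrow> i = j" using ij lss ss(1) nth_eq_iff_index_eq by metis
    have "(Q * P) $$ (i, j) =
      (\<Sum>l<n. (if f (vs ! l) = ss ! j then (if f (vs ! l) = ss ! i then 1 else 0) - 1 else 0))"
      using ij by (auto simp: P_def Q_def scalar_prod_def atLeast0LessThan intro!: sum.cong)
    also have "\<dots> = (\<Sum>v\<in>pverts G. if f v = ss ! j then (if f v = ss ! i then 1 else 0) - 1 else 0)"
      by (rule sum_vs)
    also have "\<dots> = (\<Sum>v\<in>{v \<in> pverts G. f v = ss ! j}. (if i = j then 1 else 0) - 1)"
      using V eq by (simp add: sum.If_cases Int_def) (auto intro!: sum.cong)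
    also have "\<dots> = real m * ((if i = j then 1 else 0) - 1)"
      using parts[OF sS(2)] by simp
    finally show "(c \<cdot>\<^sub>m 1\<^sub>m k + Q * P) $$ (i, j) = (real (m * k) \<cdot>\<^sub>m 1\<^sub>m k + u * w) $$ (i, j)"
      using ij dims by (auto simp: c u_def w_def scalar_prod_def)
  qed (use dims in auto)
  \<comment> \<open>\<open>w * u\<close> has the single entry - m k, which cancels the scalar and
    yields the eigenvalue 0.\<close>
  have wu: "real (m * k) \<cdot>\<^sub>m 1\<^sub>m 1 + w * u = 0 \<cdot>\<^sub>m 1\<^sub>m 1"
    by (rule eq_matI) (auto simp: u_def w_def scalar_prod_def)
  \<comment> \<open>The identity is applied twice, from size \<open>n\<close> to \<open>k\<close>
    and from \<open>k\<close> to 1. The copies of \<open>c\<close> and \<open>m * k\<close> added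
    here cancel at the end, so no multiset difference is needed.\<close>
  have "laplacian_spectrum G + replicate_mset k c + replicate_mset 1 (real (m * k))
      = replicate_mset n c + (proots (char_poly (c \<cdot>\<^sub>m 1\<^sub>m k + Q * P)) + replicate_mset 1 (real (m * k)))"
    using proots_char_poly_scalar_add_mult_commute[OF dims(1,2), of c]
    by (simp add: laplacian_spectrum_eq[OF vs] L)
  also have "\<dots> = replicate_mset n c + (replicate_mset k (real (m * k)) + {#0#})"
    using proots_char_poly_scalar_add_mult_commute[OF dims(3,4), of "real (m * k)"]
    by (simp only: QP wu char_poly_scalar_mat) simp
  also have "replicate_mset n c = replicate_mset (k * (m - 1)) c + replicate_mset k c"
    using m by (simp add: n diff_mult_distrib2 multiset_eq_iff)
  also have "replicate_mset k (real (m * k))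
      = replicate_mset (k - 1) (real (m * k)) + replicate_mset 1 (real (m * k))"
    using S(3) by (simp add: multiset_eq_iff)
  finally show ?thesis by (simp add: c_def)
qed

section \<open>The groups of unitriangular matrices\<close>

lemma V_mat_index:
  "V_mat a b c $$ (1, 0) = a" "V_mat a b c $$ (2, 0) = b" "V_mat a b c $$ (2, 1) = c"
  by (simp_all add: V_mat_def mat_of_rows_list_def numeral_eq_Suc)

lemma V_mat_eq_iff: "V_mat a b c = V_mat a' b' c' \<longleftrightarrow> a = a' \<and> b = b' \<and> c = c'"
  by (metis V_mat_index)

text \<open>Only the lower left entry of the product depends on the order. The condition says that
  (a, c) and (a', c') have determinant 0.\<close>

lemma V_mat_commute_iff:
  "V_mat a b c * V_mat a' b' c' = V_mat a' b' c' * V_mat a b c \<longleftrightarrow> c * a' = c' * a"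
  by (simp add: V_mat_mult V_mat_eq_iff
      add.commute[of a'] add.commute[of b'] add.commute[of c'])

lemma V_mat_in_group_center_iff:
  "V_mat a b c \<in> group_center (A_group TYPE('a::field)) \<longleftrightarrow> a = (0::'a) \<and> c = 0"
proof
  assume "V_mat a b c \<in> group_center (A_group TYPE('a))"
  then have "V_mat a b c * V_mat a' 0 c' = V_mat a' 0 c' * V_mat a b c" for a' c'
    by (auto simp: group_center_def A_group_def)
  then have "c * a' = c' * a" for a' c'
    unfolding V_mat_commute_iff by blast
  \<comment> \<open>Testing against (a', c') = (0, 1) forces a = 0, and against (1, 0) forces c =
    0.\<close>
  from this[of 0 1] this[of 1 0] show "a = 0 \<and> c = 0" by simp
next
  assume "a = 0 \<and> c = 0"
  then show "V_mat a b c \<in> group_center (A_group TYPE('a))"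
    by (auto simp: group_center_def A_group_def V_mat_commute_iff)
qed

text \<open>The point of the projective line with homogeneous coordinates \<open>(a, c)\<close>, which is
  \<open>None\<close> at infinity.\<close>

definition slope :: "'a::field mat \<Rightarrow> 'a option" where
  "slope x = (if x $$ (1, 0) = 0 then None else Some (x $$ (2, 1) / x $$ (1, 0)))"

lemma slope_V_mat: "slope (V_mat a b c) = (if a = 0 then None else Some (c / a))"
  unfolding slope_def V_mat_index ..

lemma pverts_non_commuting_graph_A_group:
  "pverts (non_commuting_graph (A_group TYPE('a::field)))
     = {V_mat a b c | a b c. (a::'a, c) \<noteq> (0, 0)}"
proof -
  have "pverts (non_commuting_graph (A_group TYPE('a)))
      = {V_mat a b c | a b c. True} - group_center (A_group TYPE('a))"
    by (simp add: non_commuting_graph_def A_group_def)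
  also have "\<dots> = {V_mat a b c | a b c. V_mat a b c \<notin> group_center (A_group TYPE('a))}"
    by blast
  finally show ?thesis by (simp add: V_mat_in_group_center_iff)
qed

lemma card_slope_class:
  "card {v \<in> pverts (non_commuting_graph (A_group TYPE('a::{field, finite}))). slope v = s}
     = (card (UNIV :: 'a set) - 1) * card (UNIV :: 'a set)"
proof -
  \<comment> \<open>A class is a line of slope \<open>s\<close> without the origin, times a free
    entry \<open>b\<close>. The nonzero \<open>t\<close> is the coordinate along the line:
    \<open>c\<close> at infinity, \<open>a\<close> otherwise.\<close>
  define g :: "'a \<times> 'a \<Rightarrow> 'a mat"
    where "g = (\<lambda>(t, b). case s of None \<Rightarrow> V_mat 0 b t | Some r \<Rightarrow> V_mat t b (r * t))"
  have "inj_on g ((UNIV - {0}) \<times> UNIV)"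
    by (auto simp: inj_on_def g_def V_mat_eq_iff split: option.splits)
  moreover have "{v \<in> pverts (non_commuting_graph (A_group TYPE('a))). slope v = s}
      = g ` ((UNIV - {0}) \<times> UNIV)"
  proof (intro equalityI subsetI)
    fix v assume "v \<in> {v \<in> pverts (non_commuting_graph (A_group TYPE('a))). slope v = s}"
    then obtain a b c where v: "v = V_mat a b c" "(a, c) \<noteq> (0, 0)" "slope v = s"
      by (auto simp: pverts_non_commuting_graph_A_group)
    then have "v = g (if a = 0 then c else a, b)"
      by (auto simp: g_def slope_V_mat split: option.splits)
    then show "v \<in> g ` ((UNIV - {0}) \<times> UNIV)"
      using v by (auto intro!: image_eqI)
  next
    fix v assume "v \<in> g ` ((UNIV - {0}) \<times> UNIV)"
    then show "v \<in> {v \<in> pverts (non_commuting_graph (A_group TYPE('a))). slope v = s}"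
      by (fastforce simp: g_def pverts_non_commuting_graph_A_group slope_V_mat split: option.splits)
  qed
  ultimately show ?thesis
    by (simp add: card_image card_cartesian_product card_Diff_singleton)
qed

text \<open>For vertices the pairs (a, c) are nonzero, so determinant 0 means proportional pairs,
  that is, equal slopes.\<close>

lemma parcs_non_commuting_graph_A_group:
  fixes G :: "'a::field mat pair_pre_digraph"
  defines "G \<equiv> non_commuting_graph (A_group TYPE('a))"
  shows "parcs G = {(x, y). x \<in> pverts G \<and> y \<in> pverts G \<and> slope x \<noteq> slope y}"
proof -
  have "x * y \<noteq> y * x \<longleftrightarrow> slope x \<noteq> slope y" if "x \<in> pverts G" "y \<in> pverts G" for x y
    using that
    by (auto simp: G_def pverts_non_commuting_graph_A_group V_mat_commute_iff slope_V_mat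
        field_simps split: if_splits)
  moreover have "parcs G = {(x, y). x \<in> pverts G \<and> y \<in> pverts G \<and> x * y \<noteq> y * x}"
    by (simp add: G_def non_commuting_graph_def A_group_def)
  ultimately show ?thesis by auto
qed

theorem proposition4p6:
  fixes p n :: nat
  assumes "prime p" and "n \<ge> 1"
    and "card (UNIV :: 'a::{field, finite} set) = p ^ n"
  shows "laplacian_spectrum (non_commuting_graph (A_group TYPE('a))) =
           {#0#}
           + replicate_mset (p ^ (3 * n) - 2 * p ^ n - 1) (real p ^ (3 * n) - real p ^ (2 * n))
           + replicate_mset (p ^ n) (real p ^ (3 * n) - real p ^ n)"
proof -
  let ?G = "non_commuting_graph (A_group TYPE('a))"
  define q where "q = p ^ n"
  have q: "card (UNIV :: 'a set) = q" using assms(3) by (simp add: q_def)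
  \<comment> \<open>Because 0 and 1 differ, \<open>q\<close> is at least 2: classes are nonempty,
    and writing \<open>q\<close> as \<open>Suc (Suc r)\<close> removes the truncated subtractions
    below.\<close>
  have "card {0::'a, 1} \<le> card (UNIV :: 'a set)" by (rule card_mono) auto
  then have q2: "q \<ge> 2" by (simp add: q)
  then obtain r where r: "q = Suc (Suc r)" by (metis add_2_eq_Suc le_Suc_ex)
  \<comment> \<open>The classes are indexed by the \<open>q + 1\<close> points of the projective
    line, represented by \<open>'a option\<close>.\<close>
  have "laplacian_spectrum ?G = {#0#}
      + replicate_mset (Suc q * ((q - 1) * q - 1)) (real ((q - 1) * q * (Suc q - 1)))
      + replicate_mset (Suc q - 1) (real ((q - 1) * q * Suc q))"
  proof (rule laplacian_spectrum_complete_multipartite)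
    show "card (UNIV :: 'a option set) = Suc q" by (simp add: UNIV_option_conv card_image q)
    show "finite (pverts ?G)" by (simp add: non_commuting_graph_def finite_A_group)
    show "card {v \<in> pverts ?G. slope v = s} = (q - 1) * q" for s
      using card_slope_class[of s] by (simp add: q)
    show "parcs ?G = {(x, y). x \<in> pverts ?G \<and> y \<in> pverts ?G \<and> slope x \<noteq> slope y}"
      by (rule parcs_non_commuting_graph_A_group)
  qed (use q2 in auto)
  moreover have "Suc q * ((q - 1) * q - 1) = q ^ 3 - 2 * q - 1"
    by (simp add: r power3_eq_cube algebra_simps)
  moreover have "real ((q - 1) * q * (Suc q - 1)) = real q ^ 3 - real q ^ 2"
    "real ((q - 1) * q * Suc q) = real q ^ 3 - real q"
    by (simp_all add: r power3_eq_cube power2_eq_square algebra_simps)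
  moreover have "p ^ (3 * n) = q ^ 3" "real p ^ (3 * n) = real q ^ 3"
    "real p ^ (2 * n) = real q ^ 2" "real p ^ n = real q" "p ^ n = q"
    by (simp_all add: q_def mult.commute flip: power_mult)
  ultimately show ?thesis by (simp only: diff_Suc_1)
qed

end
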